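(* Let $a>0$, $t\in\mathbb{R}$ and $n\in\mathbb{N}$. Then for all $x$, $$\sum_{k=0}^n\frac{(-n)_k(-x)_k}{k!}\,C_{n-k}(x-k;a)\,a^{-k}(1-e^{t})^k=C_n(x;ae^{-t}).$$
   Context: $\mathbb N=\{0,1,2,\dots\}$, $(y)_k=y(y+1)\cdots(y+k-1)$. The Charlier polynomials are $$C_n(x;a)=\sum_{j=0}^n\frac{(-n)_j(-x)_j}{j!}\left(-\frac1a\right)^j,$$ polynomials of degree $n$ in $x$. *)

theory Defs
  imports Complex_Main
begin

definition charlier :: "nat \<Rightarrow> 'a::field_char_0 \<Rightarrow> 'a \<Rightarrow> 'a" where
  "charlier n x a =
     (\<Sum>j=0..n. pochhammer (- of_nat n) j * pochhammer (- x) j / fact j * (- (1 / a)) ^ j)"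

end

theory Submission
  imports Defs
begin

text \<open>
  The parameter change is the binomial theorem in disguise. Expanding the inner Charlier polynomial
  gives a double sum over \<open>k\<close> and \<open>j\<close> with \<open>k + j \<le> n\<close>. The shifts \<open>n - k\<close> and \<open>x - k\<close> are
  exactly those for which \<open>(-n)\<^sub>k (-n + k)\<^sub>j = (-n)\<^bsub>k+j\<^esub>\<close> and \<open>(-x)\<^sub>k (-x + k)\<^sub>j = (-x)\<^bsub>k+j\<^esub>\<close>, so
  the Pochhammer factors depend only on the diagonal \<open>m = k + j\<close>. What remains on this diagonal is
  \<open>(u - 1/a)\<^sup>m / m!\<close> when the \<open>k\<close>-th outer term carries the weight \<open>u\<^sup>k\<close>. The weight
  \<open>u = (1 - e\<^sup>t) / a\<close> gives \<open>u - 1/a = - e\<^sup>t / a\<close>, which is the power base of the Charlier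
  polynomial with parameter \<open>a e\<^bsup>-t\<^esup>\<close>.
\<close>

lemma power_add_div_fact:
  fixes u v :: "'a::field_char_0"
  shows "(\<Sum>k\<le>m. u ^ k / fact k * (v ^ (m - k) / fact (m - k))) = (u + v) ^ m / fact m"
proof -
  have "of_nat (m choose k) * u ^ k * v ^ (m - k) / fact m
          = u ^ k / fact k * (v ^ (m - k) / fact (m - k))" if "k \<le> m" for k
    using that by (simp add: binomial_fact field_simps)
  then show ?thesis
    by (simp add: binomial_ring sum_divide_distrib)
qed

text \<open>With \<open>u\<close> free, both sides are polynomials in \<open>u\<close>: reparametrizing a Charlier polynomial is a
  translation of its power base \<open>- (1 / a)\<close>, and the exponential enters only as one choice of \<open>u\<close>.\<close>

lemma sum_charlier_shift:
  fixes x a u :: "'a::field_char_0"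
  shows "(\<Sum>k=0..n. pochhammer (- of_nat n) k * pochhammer (- x) k / fact k
            * charlier (n - k) (x - of_nat k) a * u ^ k)
         = (\<Sum>m=0..n. pochhammer (- of_nat n) m * pochhammer (- x) m / fact m
            * (u + - (1 / a)) ^ m)"
proof -
  define P where "P m = pochhammer (- of_nat n :: 'a) m * pochhammer (- x) m" for m
  define v where "v = - (1 / a)"
  have inner: "P k / fact k * charlier (n - k) (x - of_nat k) a * u ^ k
      = (\<Sum>j\<le>n - k. P (k + j) * (u ^ k / fact k * (v ^ j / fact j)))" if "k \<le> n" for k
  proof -
    have "P (k + j) = P k * (pochhammer (- of_nat (n - k)) j * pochhammer (- (x - of_nat k)) j)"
      for j
      using that unfolding P_def pochhammer_product' by (simp add: of_nat_diff add.commute)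
    then show ?thesis
      by (simp add: charlier_def v_def sum_distrib_left sum_distrib_right atLeast0AtMost mult_ac)
  qed
  have "(\<Sum>k\<le>n. P k / fact k * charlier (n - k) (x - of_nat k) a * u ^ k)
      = (\<Sum>k\<le>n. \<Sum>j\<le>n - k. P (k + j) * (u ^ k / fact k * (v ^ j / fact j)))"
    by (intro sum.cong refl inner) simp
  also have "\<dots> = (\<Sum>(k, j)\<in>{(k, j). k + j \<le> n}. P (k + j) * (u ^ k / fact k * (v ^ j / fact j)))"
    by (subst sum.Sigma) (auto intro!: sum.cong)
  also have "\<dots> = (\<Sum>m\<le>n. \<Sum>k\<le>m. P m * (u ^ k / fact k * (v ^ (m - k) / fact (m - k))))"
    by (simp add: sum.triangle_reindex_eq)
  also have "\<dots> = (\<Sum>m\<le>n. P m / fact m * (u + v) ^ m)"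
    by (simp only: sum_distrib_left [symmetric] power_add_div_fact) simp
  finally show ?thesis
    by (simp add: P_def v_def atLeast0AtMost)
qed

theorem mainTheorem19:
  fixes a t :: real and n :: nat and x :: complex
  assumes "a > 0"
  shows "(\<Sum>k=0..n. pochhammer (- of_nat n) k * pochhammer (- x) k / fact k
            * charlier (n - k) (x - of_nat k) (of_real a)
            * of_real a powi (- int k) * (1 - of_real (exp t)) ^ k)
         = charlier n x (of_real (a * exp (- t)))"
proof -
  define u :: complex where "u = (1 - of_real (exp t)) / of_real a"
  have weight: "y * of_real a powi (- int k) * (1 - of_real (exp t)) ^ k = y * u ^ k"
    for y :: complex and k
    by (simp add: u_def power_int_minus power_divide field_simps)
  have base: "u + - (1 / of_real a) = - (1 / of_real (a * exp (- t)))"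
    using assms by (simp add: u_def exp_minus field_simps)
  show ?thesis
    unfolding weight sum_charlier_shift base by (simp only: charlier_def)
qed

end
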